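(* Let $\sigma$ be the signature consisting of three binary relation symbols $\leq$, $S$, $E$ and one unary relation symbol $B$. There exists a sentence $\varphi \in \mathsf{FO}[\sigma]$ that is preserved under disjoint unions over $\mathrm{Fin}(\sigma)$ but is not equivalent over $\mathrm{Fin}(\sigma)$ to an existential local sentence.
   Context: $\mathrm{Fin}(\sigma)$ is the class of all finite $\sigma$-structures (the symbol $\leq$ is an arbitrary binary relation symbol). A sentence $\varphi$ is preserved (closed) under disjoint unions over $\mathrm{Fin}(\sigma)$ if for all $A, A' \in \mathrm{Fin}(\sigma)$, $A \models \varphi$ implies $A \uplus A' \models \varphi$. The Gaifman graph of a structure $A$ has the elements of $A$ as vertices and an edge between two elements whenever they occur together in some tuple of a relation of $A$; $d_A$ is the distance in this graph. For a tuple $\mathbf{a}$ of elements of $A$ and $r \in \mathbb{N}$, $\mathcal{N}_A(\mathbf{a},r) = \{a' \in A \mid \exists a \in \mathbf{a},\ d_A(a,a') \le r\}$, identified with the induced substructure of $A$ on this set. A first-order formula $\varphi(\mathbf{x})$ is $r$-local if for every structure $A$ and tuple $\mathbf{a}$ from $A$: $A,\mathbf{a} \models \varphi$ iff $\mathcal{N}_A(\mathbf{a},r),\mathbf{a} \models \varphi$. An existential local sentence is a sentence $\exists \mathbf{x}.\, \tau(\mathbf{x})$ where $\tau$ is a first-order $r$-local formula for some $r \in \mathbb{N}$. Equivalence over $\mathrm{Fin}(\sigma)$ means having the same finite models. *)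

theory Defs
  imports Main "HOL-Library.Extended_Nat"
begin

section \<open>Relational structures\<close>

text \<open>
  A relational signature is a type \<open>'s\<close> of relation symbols together with an arity
  function \<open>ar :: 's \<Rightarrow> nat\<close>. The universe is a subset of a type; it may be empty, so that
  the neighbourhood of the empty tuple is again a structure.
\<close>

record ('a, 's) struct =
  univ :: "'a set"
  rel :: "'s \<Rightarrow> 'a list set"

definition is_struct :: "('s \<Rightarrow> nat) \<Rightarrow> ('a, 's) struct \<Rightarrow> bool" where
  "is_struct ar A \<longleftrightarrow> (\<forall>R. \<forall>t \<in> rel A R. length t = ar R \<and> set t \<subseteq> univ A)"

definition finite_struct :: "('s \<Rightarrow> nat) \<Rightarrow> ('a, 's) struct \<Rightarrow> bool" where
  "finite_struct ar A \<longleftrightarrow> is_struct ar A \<and> finite (univ A)"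

definition disj_union :: "('a, 's) struct \<Rightarrow> ('b, 's) struct \<Rightarrow> ('a + 'b, 's) struct"
    (infixr "\<uplus>" 65) where
  "A \<uplus> A' =
    \<lparr>univ = univ A <+> univ A',
     rel = (\<lambda>R. map Inl ` rel A R \<union> map Inr ` rel A' R)\<rparr>"

definition induced :: "('a, 's) struct \<Rightarrow> 'a set \<Rightarrow> ('a, 's) struct" where
  "induced A X =
    \<lparr>univ = univ A \<inter> X, rel = (\<lambda>R. {t \<in> rel A R. set t \<subseteq> X})\<rparr>"

section \<open>Gaifman graph and neighbourhoods\<close>

text \<open>Loops are included in \<open>gaifman\<close>; they do not affect distances.\<close>

definition gaifman :: "('a, 's) struct \<Rightarrow> ('a \<times> 'a) set" where
  "gaifman A = {(a, b). \<exists>R. \<exists>t \<in> rel A R. a \<in> set t \<and> b \<in> set t}"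

text \<open>The infimum over the empty set of path lengths is \<open>\<infinity>\<close>.\<close>

definition gdist :: "('a, 's) struct \<Rightarrow> 'a \<Rightarrow> 'a \<Rightarrow> enat" where
  "gdist A a b = (INF k \<in> {k. (a, b) \<in> gaifman A ^^ k}. enat k)"

definition nbhd :: "('a, 's) struct \<Rightarrow> 'a set \<Rightarrow> nat \<Rightarrow> ('a, 's) struct" where
  "nbhd A X r = induced A {a' \<in> univ A. \<exists>a \<in> X. gdist A a a' \<le> enat r}"

section \<open>First-order logic with equality\<close>

datatype 's fm =
    Eq nat nat
  | Rel 's "nat list"
  | Neg "'s fm"
  | Conj "'s fm" "'s fm"
  | Ex nat "'s fm"

primrec wf_fm :: "('s \<Rightarrow> nat) \<Rightarrow> 's fm \<Rightarrow> bool" where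
  "wf_fm ar (Eq x y) \<longleftrightarrow> True"
| "wf_fm ar (Rel R xs) \<longleftrightarrow> length xs = ar R"
| "wf_fm ar (Neg \<phi>) \<longleftrightarrow> wf_fm ar \<phi>"
| "wf_fm ar (Conj \<phi> \<psi>) \<longleftrightarrow> wf_fm ar \<phi> \<and> wf_fm ar \<psi>"
| "wf_fm ar (Ex x \<phi>) \<longleftrightarrow> wf_fm ar \<phi>"

primrec fv :: "'s fm \<Rightarrow> nat set" where
  "fv (Eq x y) = {x, y}"
| "fv (Rel R xs) = set xs"
| "fv (Neg \<phi>) = fv \<phi>"
| "fv (Conj \<phi> \<psi>) = fv \<phi> \<union> fv \<psi>"
| "fv (Ex x \<phi>) = fv \<phi> - {x}"

primrec sat :: "('a, 's) struct \<Rightarrow> (nat \<Rightarrow> 'a) \<Rightarrow> 's fm \<Rightarrow> bool" where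
  "sat A v (Eq x y) \<longleftrightarrow> v x = v y"
| "sat A v (Rel R xs) \<longleftrightarrow> map v xs \<in> rel A R"
| "sat A v (Neg \<phi>) \<longleftrightarrow> \<not> sat A v \<phi>"
| "sat A v (Conj \<phi> \<psi>) \<longleftrightarrow> sat A v \<phi> \<and> sat A v \<psi>"
| "sat A v (Ex x \<phi>) \<longleftrightarrow> (\<exists>a \<in> univ A. sat A (v(x := a)) \<phi>)"

definition is_sentence :: "('s \<Rightarrow> nat) \<Rightarrow> 's fm \<Rightarrow> bool" where
  "is_sentence ar \<phi> \<longleftrightarrow> wf_fm ar \<phi> \<and> fv \<phi> = {}"

text \<open>Used for sentences only, whose truth does not depend on the assignment \<open>v\<close>.\<close>

definition models :: "('a, 's) struct \<Rightarrow> 's fm \<Rightarrow> bool" (infix "\<Turnstile>" 50) where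
  "A \<Turnstile> \<phi> \<longleftrightarrow> (\<forall>v. sat A v \<phi>)"

section \<open>Locality, preservation and equivalence\<close>

text \<open>
  From here on, structures have their universe inside \<open>nat\<close>. Every finite structure has an
  isomorphic copy of this kind. In the definition of locality all structures, finite or
  infinite, are meant: for a finite signature, membership in the \<open>r\<close>-neighbourhood is
  first-order definable, so by the downward Loewenheim-Skolem theorem countable structures
  suffice.

  The tuple interpreting the variables \<open>xs\<close> is \<open>map v xs\<close>; the values of \<open>v\<close> elsewhere are
  irrelevant since the free variables of \<open>\<tau>\<close> are among \<open>xs\<close>.
\<close>

definition local_fm :: "('s \<Rightarrow> nat) \<Rightarrow> nat \<Rightarrow> nat list \<Rightarrow> 's fm \<Rightarrow> bool" where
  "local_fm ar r xs \<tau> \<longleftrightarrow>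
    wf_fm ar \<tau> \<and> fv \<tau> \<subseteq> set xs \<and>
    (\<forall>(A :: (nat, 's) struct) v. is_struct ar A \<longrightarrow> v ` set xs \<subseteq> univ A \<longrightarrow>
      (sat A v \<tau> \<longleftrightarrow> sat (nbhd A (v ` set xs) r) v \<tau>))"

definition existential_local :: "('s \<Rightarrow> nat) \<Rightarrow> 's fm \<Rightarrow> bool" where
  "existential_local ar \<psi> \<longleftrightarrow>
    (\<exists>xs \<tau> r. distinct xs \<and> local_fm ar r xs \<tau> \<and> \<psi> = foldr Ex xs \<tau>)"

definition preserved_disj_union :: "('s \<Rightarrow> nat) \<Rightarrow> 's fm \<Rightarrow> bool" where
  "preserved_disj_union ar \<phi> \<longleftrightarrow>
    (\<forall>(A :: (nat, 's) struct) (A' :: (nat, 's) struct).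
      finite_struct ar A \<longrightarrow> finite_struct ar A' \<longrightarrow> A \<Turnstile> \<phi> \<longrightarrow> A \<uplus> A' \<Turnstile> \<phi>)"

definition equiv_fin :: "('s \<Rightarrow> nat) \<Rightarrow> 's fm \<Rightarrow> 's fm \<Rightarrow> bool" where
  "equiv_fin ar \<phi> \<psi> \<longleftrightarrow>
    (\<forall>A :: (nat, 's) struct. finite_struct ar A \<longrightarrow> (A \<Turnstile> \<phi> \<longleftrightarrow> A \<Turnstile> \<psi>))"

section \<open>The signature\<close>

datatype sym = Sym_leq | Sym_S | Sym_E | Sym_B

primrec sigma_ar :: "sym \<Rightarrow> nat" where
  "sigma_ar Sym_leq = 2"
| "sigma_ar Sym_S = 2"
| "sigma_ar Sym_E = 2"
| "sigma_ar Sym_B = 1"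

end

theory Submission
  imports Defs
begin

text \<open>
  Call a vertex an \<^emph>\<open>end\<close> if it lacks an \<open>S\<close>- or an \<open>E\<close>-successor or has two incoming edges.
  Every nonempty finite structure has an end: otherwise \<open>S\<close> and \<open>E\<close> would contain injections of
  the universe into itself with disjoint images. Hence the sentence "there are two ends, or
  there is an end and \<open>B\<close> is empty" is preserved under disjoint unions of finite structures.

  In a complete binary tree whose leaves all point to one additional vertex, that vertex is the
  only end. If the tree is deep enough, any given number of balls of given radius misses some
  vertex, and putting \<open>B\<close> there falsifies the sentence without changing the balls.
\<close>

section \<open>First-order semantics\<close>

lemma sat_cong_fv: "(\<And>x. x \<in> fv \<phi> \<Longrightarrow> v x = w x) \<Longrightarrow> sat A v \<phi> \<longleftrightarrow> sat A w \<phi>"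
proof (induction \<phi> arbitrary: v w)
  case (Rel R xs)
  then have "map v xs = map w xs" by simp
  then show ?case by (simp only: sat.simps)
next
  case (Conj \<phi> \<psi>)
  have "sat A v \<phi> \<longleftrightarrow> sat A w \<phi>" "sat A v \<psi> \<longleftrightarrow> sat A w \<psi>"
    using Conj.prems by (auto intro!: Conj.IH)
  then show ?case by simp
next
  case (Neg \<phi>)
  have "sat A v \<phi> \<longleftrightarrow> sat A w \<phi>"
    using Neg.prems by (auto intro!: Neg.IH)
  then show ?case by simp
next
  case (Ex x \<phi>)
  have "sat A (v(x := a)) \<phi> \<longleftrightarrow> sat A (w(x := a)) \<phi>" for a
    using Ex.prems by (intro Ex.IH) auto
  then show ?case by simp
qed auto

lemma sat_foldr_Ex:
  "distinct xs \<Longrightarrow> sat A v (foldr Ex xs \<tau>) \<longleftrightarrow>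
    (\<exists>w. (\<forall>x. x \<notin> set xs \<longrightarrow> w x = v x) \<and> w ` set xs \<subseteq> univ A \<and> sat A w \<tau>)"
proof (induction xs arbitrary: v)
  case Nil
  have "w = v" if "\<forall>x. w x = v x" for w
    using that by auto
  then show ?case by auto
next
  case (Cons x xs)
  then have x: "x \<notin> set xs"
    and IH: "\<And>v. sat A v (foldr Ex xs \<tau>) \<longleftrightarrow>
      (\<exists>w. (\<forall>y. y \<notin> set xs \<longrightarrow> w y = v y) \<and> w ` set xs \<subseteq> univ A \<and> sat A w \<tau>)"
    by auto
  show ?case (is "?L \<longleftrightarrow> ?R")
  proof
    assume ?L
    then obtain a w where a: "a \<in> univ A" and w: "w ` set xs \<subseteq> univ A" "sat A w \<tau>"
      and eq: "\<forall>y. y \<notin> set xs \<longrightarrow> w y = (v(x := a)) y"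
      by (auto simp: IH)
    \<comment> \<open>Since \<open>x\<close> does not recur in \<open>xs\<close>, the inner
      quantifiers leave its value \<open>a\<close> alone.\<close>
    moreover have "w x = a" using eq x by simp
    ultimately show ?R by (intro exI[of _ w]) auto
  next
    assume ?R
    then obtain w where "w ` set (x # xs) \<subseteq> univ A" "sat A w \<tau>"
      "\<forall>y. y \<notin> set (x # xs) \<longrightarrow> w y = v y" by blast
    then show ?L by (auto simp: IH intro!: bexI[of _ "w x"] exI[of _ w])
  qed
qed

lemma models_foldr_Ex:
  assumes "distinct xs" "fv \<tau> \<subseteq> set xs"
  shows "A \<Turnstile> foldr Ex xs \<tau> \<longleftrightarrow> (\<exists>v. v ` set xs \<subseteq> univ A \<and> sat A v \<tau>)"
proof
  assume "A \<Turnstile> foldr Ex xs \<tau>"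
  then show "\<exists>v. v ` set xs \<subseteq> univ A \<and> sat A v \<tau>"
    unfolding models_def sat_foldr_Ex[OF assms(1)] by blast
next
  assume "\<exists>v. v ` set xs \<subseteq> univ A \<and> sat A v \<tau>"
  then obtain v where v: "v ` set xs \<subseteq> univ A" "sat A v \<tau>" by blast
  show "A \<Turnstile> foldr Ex xs \<tau>"
    unfolding models_def sat_foldr_Ex[OF assms(1)]
  proof
    fix v0
    let ?w = "\<lambda>x. if x \<in> set xs then v x else v0 x"
    have "sat A ?w \<tau>"
      using v(2) assms(2) by (subst sat_cong_fv[of \<tau> _ v]) auto
    then show "\<exists>w. (\<forall>x. x \<notin> set xs \<longrightarrow> w x = v0 x) \<and> w ` set xs \<subseteq> univ A \<and> sat A w \<tau>"
      using v(1) by (intro exI[of _ ?w]) auto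
  qed
qed

text \<open>Locality carries \<open>\<tau>\<close> from \<open>A\<close> to the common neighbourhood
  and on to \<open>A'\<close>. The neighbourhoods are equal, not merely isomorphic, so one
  assignment serves both structures.\<close>

lemma existential_local_transfer:
  fixes A A' :: "(nat, 's) struct"
  assumes "local_fm ar r xs \<tau>" "distinct xs" "is_struct ar A" "is_struct ar A'"
    and "v ` set xs \<subseteq> univ A" "v ` set xs \<subseteq> univ A'" "sat A v \<tau>"
    and "nbhd A (v ` set xs) r = nbhd A' (v ` set xs) r"
  shows "A' \<Turnstile> foldr Ex xs \<tau>"
proof -
  have "sat A' v \<tau>"
    using assms unfolding local_fm_def by metis
  then show ?thesis
    using assms models_foldr_Ex[of xs \<tau> A'] by (auto simp: local_fm_def)
qed

text \<open>\<open>enat\<close> is well-ordered, so the infimum over a nonempty set is attained; a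
  finite bound excludes the empty set.\<close>

lemma gdist_le_enat: "gdist A a b \<le> enat r \<longleftrightarrow> (\<exists>k\<le>r. (a, b) \<in> gaifman A ^^ k)"
proof
  let ?K = "{k. (a, b) \<in> gaifman A ^^ k}"
  assume le: "gdist A a b \<le> enat r"
  then have "enat ` ?K \<noteq> {}"
    by (metis gdist_def Inf_empty top_enat_def top.extremum_unique enat.distinct(1))
  then have "Inf (enat ` ?K) \<in> enat ` ?K"
    by (metis wellorder_InfI ex_in_conv)
  then show "\<exists>k\<le>r. (a, b) \<in> gaifman A ^^ k"
    using le by (auto simp: gdist_def)
next
  assume "\<exists>k\<le>r. (a, b) \<in> gaifman A ^^ k"
  then show "gdist A a b \<le> enat r"
    unfolding gdist_def by (auto intro: INF_lower2)
qed

section \<open>Ends\<close>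

text \<open>The mixed clause allows \<open>y = z\<close>: an \<open>S\<close>-edge and an
  \<open>E\<close>-edge from the same vertex count as two incoming edges.\<close>

definition is_end :: "('a, sym) struct \<Rightarrow> 'a \<Rightarrow> bool" where
  "is_end A x \<longleftrightarrow>
    \<not> ((\<exists>y\<in>univ A. [x, y] \<in> rel A Sym_S) \<and> (\<exists>y\<in>univ A. [x, y] \<in> rel A Sym_E) \<and>
      \<not> (\<exists>y\<in>univ A. \<exists>z\<in>univ A. [y, x] \<in> rel A Sym_S \<and> [z, x] \<in> rel A Sym_E) \<and>
      \<not> (\<exists>y\<in>univ A. \<exists>z\<in>univ A. y \<noteq> z \<and> [y, x] \<in> rel A Sym_S \<and> [z, x] \<in> rel A Sym_S) \<and>
      \<not> (\<exists>y\<in>univ A. \<exists>z\<in>univ A. y \<noteq> z \<and> [y, x] \<in> rel A Sym_E \<and> [z, x] \<in> rel A Sym_E))"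

lemma exists_end:
  assumes "finite (univ A)" "univ A \<noteq> {}"
  shows "\<exists>x\<in>univ A. is_end A x"
proof (rule ccontr)
  assume "\<not> ?thesis"
  then have S: "\<forall>x\<in>univ A. \<exists>y\<in>univ A. [x, y] \<in> rel A Sym_S"
    and E: "\<forall>x\<in>univ A. \<exists>y\<in>univ A. [x, y] \<in> rel A Sym_E"
    and SE: "\<And>x y z. x \<in> univ A \<Longrightarrow> y \<in> univ A \<Longrightarrow> z \<in> univ A \<Longrightarrow>
      [y, x] \<in> rel A Sym_S \<Longrightarrow> [z, x] \<in> rel A Sym_E \<Longrightarrow> False"
    and SS: "\<And>x y z. x \<in> univ A \<Longrightarrow> y \<in> univ A \<Longrightarrow> z \<in> univ A \<Longrightarrow>
      [y, x] \<in> rel A Sym_S \<Longrightarrow> [z, x] \<in> rel A Sym_S \<Longrightarrow> y = z"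
    and EE: "\<And>x y z. x \<in> univ A \<Longrightarrow> y \<in> univ A \<Longrightarrow> z \<in> univ A \<Longrightarrow>
      [y, x] \<in> rel A Sym_E \<Longrightarrow> [z, x] \<in> rel A Sym_E \<Longrightarrow> y = z"
    unfolding is_end_def by blast+
  obtain f where f: "\<And>x. x \<in> univ A \<Longrightarrow> f x \<in> univ A \<and> [x, f x] \<in> rel A Sym_S"
    using S by metis
  obtain g where g: "\<And>x. x \<in> univ A \<Longrightarrow> g x \<in> univ A \<and> [x, g x] \<in> rel A Sym_E"
    using E by metis
  have "inj_on f (univ A)"
  proof (rule inj_onI)
    fix y z assume "y \<in> univ A" "z \<in> univ A" "f y = f z"
    then show "y = z" using f[of y] f[of z] SS[of "f y" y z] by simp
  qed
  moreover have "inj_on g (univ A)"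
  proof (rule inj_onI)
    fix y z assume "y \<in> univ A" "z \<in> univ A" "g y = g z"
    then show "y = z" using g[of y] g[of z] EE[of "g y" y z] by simp
  qed
  moreover have "f ` univ A \<inter> g ` univ A = {}"
  proof (rule ccontr)
    assume "f ` univ A \<inter> g ` univ A \<noteq> {}"
    then obtain y z where "y \<in> univ A" "z \<in> univ A" "f y = g z" by blast
    then show False
      using f[of y] g[of z] SE[of "f y" y z] by simp
  qed
  ultimately have "card (f ` univ A \<union> g ` univ A) = card (univ A) + card (univ A)"
    using assms(1) by (simp add: card_Un_disjoint card_image)
  moreover have "card (f ` univ A \<union> g ` univ A) \<le> card (univ A)"
    using assms(1) f g by (intro card_mono Un_least image_subsetI) simp_all
  ultimately show False
    using assms by simp
qed

section \<open>The sentence about ends and its preservation\<close>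

definition fm_end :: "nat \<Rightarrow> sym fm" where
  "fm_end x = Neg (Conj (Ex 2 (Rel Sym_S [x, 2])) (Conj (Ex 2 (Rel Sym_E [x, 2]))
    (Conj (Neg (Ex 2 (Ex 3 (Conj (Rel Sym_S [2, x]) (Rel Sym_E [3, x])))))
    (Conj (Neg (Ex 2 (Ex 3 (Conj (Neg (Eq 2 3)) (Conj (Rel Sym_S [2, x]) (Rel Sym_S [3, x]))))))
      (Neg (Ex 2 (Ex 3 (Conj (Neg (Eq 2 3)) (Conj (Rel Sym_E [2, x]) (Rel Sym_E [3, x]))))))))))"

text \<open>Variables 2 and 3 are bound inside \<open>fm_end\<close>, so \<open>x < 2\<close> avoids
  capture.\<close>

lemma sat_fm_end: "x < 2 \<Longrightarrow> sat A v (fm_end x) \<longleftrightarrow> is_end A (v x)"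
  by (simp add: fm_end_def is_end_def)

text \<open>A disjunction in De Morgan form. The second disjunct demands an end so that the empty
  structure is no model: its union with a structure having one end and nonempty \<open>B\<close>
  would be none.\<close>

definition fm_ends :: "sym fm" where
  "fm_ends = Neg (Conj
    (Neg (Ex 0 (Ex 1 (Conj (Neg (Eq 0 1)) (Conj (fm_end 0) (fm_end 1))))))
    (Neg (Conj (Ex 0 (fm_end 0)) (Neg (Ex 0 (Rel Sym_B [0]))))))"

lemma models_fm_ends: "A \<Turnstile> fm_ends \<longleftrightarrow>
    (\<exists>x\<in>univ A. \<exists>y\<in>univ A. x \<noteq> y \<and> is_end A x \<and> is_end A y) \<or>
    (\<exists>x\<in>univ A. is_end A x) \<and> (\<forall>x\<in>univ A. [x] \<notin> rel A Sym_B)"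
  by (auto simp: models_def fm_ends_def sat_fm_end)

lemma is_sentence_fm_ends: "is_sentence sigma_ar fm_ends"
  by (auto simp: is_sentence_def fm_ends_def fm_end_def)

lemma bex_univ_disj_union:
  "(\<exists>z\<in>univ (A \<uplus> A'). P z) \<longleftrightarrow> (\<exists>x\<in>univ A. P (Inl x)) \<or> (\<exists>y\<in>univ A'. P (Inr y))"
  by (auto simp: disj_union_def)

lemma pair_mem_rel_disj_union:
  "[Inl x, Inl y] \<in> rel (A \<uplus> A') R \<longleftrightarrow> [x, y] \<in> rel A R"
  "[Inr x', Inr y'] \<in> rel (A \<uplus> A') R \<longleftrightarrow> [x', y'] \<in> rel A' R"
  "[Inl x, Inr y'] \<notin> rel (A \<uplus> A') R"
  "[Inr x', Inl y] \<notin> rel (A \<uplus> A') R"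
  by (auto simp: disj_union_def image_iff Cons_eq_map_conv)

text \<open>No edge joins the two summands, so all successors and predecessors stay on one
  side.\<close>

lemma is_end_Inl: "is_end (A \<uplus> A') (Inl x) \<longleftrightarrow> is_end A x"
  by (simp add: is_end_def bex_univ_disj_union pair_mem_rel_disj_union)

lemma is_end_Inr: "is_end (A \<uplus> A') (Inr x) \<longleftrightarrow> is_end A' x"
  by (simp add: is_end_def bex_univ_disj_union pair_mem_rel_disj_union)

text \<open>Ends of \<open>A\<close> remain ends. If just one is given, a nonempty \<open>A'\<close>
  adds another by \<open>exists_end\<close>, while an empty \<open>A'\<close> keeps \<open>B\<close>
  empty.\<close>

lemma preserved_fm_ends: "preserved_disj_union sigma_ar fm_ends"
  unfolding preserved_disj_union_def
proof (intro allI impI)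
  fix A A' :: "(nat, sym) struct"
  assume fin: "finite_struct sigma_ar A'" and "A \<Turnstile> fm_ends"
  then consider x y where "x \<in> univ A" "y \<in> univ A" "x \<noteq> y" "is_end A x" "is_end A y"
    | x where "x \<in> univ A" "is_end A x" "\<forall>y\<in>univ A. [y] \<notin> rel A Sym_B"
    unfolding models_fm_ends by blast
  then show "A \<uplus> A' \<Turnstile> fm_ends"
  proof cases
    case (1 x y)
    then have "Inl x \<in> univ (A \<uplus> A')" "Inl y \<in> univ (A \<uplus> A')"
      by (auto simp: disj_union_def)
    with 1 show ?thesis
      unfolding models_fm_ends by (metis is_end_Inl Inl_inject)
  next
    case (2 x)
    then have x: "Inl x \<in> univ (A \<uplus> A')" "is_end (A \<uplus> A') (Inl x)"
      unfolding is_end_Inl by (auto simp: disj_union_def)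
    show ?thesis
    proof (cases "univ A' = {}")
      case True
      then have "\<forall>y\<in>univ (A \<uplus> A'). [y] \<notin> rel (A \<uplus> A') Sym_B"
        using 2(3) by (auto simp: disj_union_def image_iff Cons_eq_map_conv)
      with x show ?thesis
        unfolding models_fm_ends by blast
    next
      case False
      then obtain y where "y \<in> univ A'" "is_end A' y"
        using exists_end[of A'] fin by (auto simp: finite_struct_def)
      then have "Inr y \<in> univ (A \<uplus> A')" "is_end (A \<uplus> A') (Inr y)"
        unfolding is_end_Inr by (auto simp: disj_union_def)
      with x show ?thesis
        unfolding models_fm_ends by (metis Inl_Inr_False)
    qed
  qed
qed

section \<open>Binary trees with a sink\<close>

text \<open>
  The vertices are numbered as in a binary heap: the root is 1, the children of \<open>i\<close> are
  \<open>2 * i\<close> and \<open>2 * i + 1\<close>, and 0 is the sink. The set \<open>P\<close> interprets \<open>B\<close>.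
\<close>

definition tree_S :: "nat \<Rightarrow> nat \<Rightarrow> nat" where
  "tree_S n i = (if 2 * i < 2 ^ n then 2 * i else 0)"

definition tree_E :: "nat \<Rightarrow> nat \<Rightarrow> nat" where
  "tree_E n i = (if 2 * i + 1 < 2 ^ n then 2 * i + 1 else 0)"

text \<open>The vertices from 1 to \<open>2 ^ n - 1\<close> form \<open>n\<close> full levels. The
  sink gets no outgoing edge, which makes it an end.\<close>

definition tree :: "nat \<Rightarrow> nat set \<Rightarrow> (nat, sym) struct" where
  "tree n P = \<lparr>univ = {..<2 ^ n}, rel = (\<lambda>R. case R of
      Sym_leq \<Rightarrow> {}
    | Sym_S \<Rightarrow> {[i, tree_S n i] | i. 0 < i \<and> i < 2 ^ n}
    | Sym_E \<Rightarrow> {[i, tree_E n i] | i. 0 < i \<and> i < 2 ^ n}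
    | Sym_B \<Rightarrow> {[i] | i. i \<in> P})\<rparr>"

lemma univ_tree [simp]: "univ (tree n P) = {..<2 ^ n}"
  by (simp add: tree_def)

lemma rel_tree [simp]:
  "rel (tree n P) Sym_leq = {}"
  "rel (tree n P) Sym_S = {[i, tree_S n i] | i. 0 < i \<and> i < 2 ^ n}"
  "rel (tree n P) Sym_E = {[i, tree_E n i] | i. 0 < i \<and> i < 2 ^ n}"
  "rel (tree n P) Sym_B = {[i] | i. i \<in> P}"
  by (simp_all add: tree_def)

lemma finite_struct_tree:
  assumes "P \<subseteq> {..<2 ^ n}"
  shows "finite_struct sigma_ar (tree n P)"
proof -
  have "length t = sigma_ar R \<and> set t \<subseteq> {..<2 ^ n}" if "t \<in> rel (tree n P) R" for t R
    using that assms by (cases R) (auto simp: tree_S_def tree_E_def)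
  then show ?thesis
    by (auto simp: finite_struct_def is_struct_def)
qed

text \<open>An edge into \<open>x \<noteq> 0\<close> can only come from \<open>x div 2\<close>, in
  \<open>S\<close> if \<open>x\<close> is even and in \<open>E\<close> if it is odd, so there are
  never two.\<close>

lemma is_end_tree: "x < 2 ^ n \<Longrightarrow> is_end (tree n P) x \<longleftrightarrow> x = 0"
proof
  assume x: "x < 2 ^ n" and "is_end (tree n P) x"
  show "x = 0"
  proof (rule ccontr)
    assume "x \<noteq> 0"
    moreover have "tree_S n x < 2 ^ n" "tree_E n x < 2 ^ n"
      by (auto simp: tree_S_def tree_E_def)
    moreover have "y = x div 2 \<and> even x" if "x = tree_S n y" for y
      using that \<open>x \<noteq> 0\<close> by (auto simp: tree_S_def split: if_splits)
    moreover have "y = x div 2 \<and> odd x" if "x = tree_E n y" for y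
      using that \<open>x \<noteq> 0\<close> by (auto simp: tree_E_def split: if_splits)
    ultimately have "\<not> is_end (tree n P) x"
      unfolding is_end_def using x by (auto; metis)
    with \<open>is_end (tree n P) x\<close> show False by contradiction
  qed
qed (simp add: is_end_def)

lemma models_tree: "P \<subseteq> {..<2 ^ n} \<Longrightarrow> tree n P \<Turnstile> fm_ends \<longleftrightarrow> P = {}"
  unfolding models_fm_ends by (auto simp: is_end_tree)

section \<open>Distances in the tree\<close>

lemma gaifman_tree_cases:
  assumes "(x, y) \<in> gaifman (tree n P)" "x \<noteq> y"
  shows "0 < x \<and> (y = tree_S n x \<or> y = tree_E n x) \<or> 0 < y \<and> (x = tree_S n y \<or> x = tree_E n y)"
proof -
  obtain R t where "t \<in> rel (tree n P) R" "x \<in> set t" "y \<in> set t"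
    using assms(1) by (auto simp: gaifman_def)
  with assms(2) show ?thesis
    by (cases R) auto
qed

text \<open>A unary tuple contributes only a loop, and a nonzero vertex already has that loop from
  its \<open>S\<close>-tuple.\<close>

lemma gaifman_tree:
  assumes "0 \<notin> P" "P \<subseteq> {..<2 ^ n}"
  shows "gaifman (tree n P) = gaifman (tree n {})"
proof
  show "gaifman (tree n {}) \<subseteq> gaifman (tree n P)"
  proof clarify
    fix x y assume "(x, y) \<in> gaifman (tree n {})"
    then obtain R t where "t \<in> rel (tree n {}) R" "x \<in> set t" "y \<in> set t"
      by (auto simp: gaifman_def)
    moreover have "rel (tree n {}) R \<subseteq> rel (tree n P) R"
      by (cases R) auto
    ultimately show "(x, y) \<in> gaifman (tree n P)"
      by (auto simp: gaifman_def)
  qed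
  show "gaifman (tree n P) \<subseteq> gaifman (tree n {})"
  proof clarify
    fix x y assume "(x, y) \<in> gaifman (tree n P)"
    then obtain R t where t: "t \<in> rel (tree n P) R" "x \<in> set t" "y \<in> set t"
      by (auto simp: gaifman_def)
    show "(x, y) \<in> gaifman (tree n {})"
    proof (cases "R = Sym_B")
      case True
      then have "x = y" "x \<in> P" using t by auto
      then have "[x, tree_S n x] \<in> rel (tree n {}) Sym_S"
        using assms by (auto intro: gr0I)
      then show ?thesis
        unfolding gaifman_def \<open>x = y\<close>[symmetric]
        by (auto intro!: exI[of _ Sym_S] bexI[of _ "[x, tree_S n x]"] simp del: rel_tree)
    next
      case False
      then have "t \<in> rel (tree n {}) R"
        using t(1) by (cases R) auto
      then show ?thesis
        using t by (auto simp: gaifman_def)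
    qed
  qed
qed

text \<open>
  A walk of length at most \<open>r\<close> from \<open>a * 2 ^ r\<close> leaves the subtree rooted at \<open>a\<close> neither
  through \<open>a\<close> nor through a leaf.
\<close>

lemma tree_walk_ancestor:
  assumes a: "0 < a" "a < 2 ^ Suc q" and n: "n = q + 2 * r + 1"
  shows "(x, a * 2 ^ r) \<in> gaifman (tree n P) ^^ k \<Longrightarrow> k \<le> r \<Longrightarrow>
    \<exists>t. r \<le> t + k \<and> t \<le> r + k \<and> x div 2 ^ t = a"
proof (induction k arbitrary: x)
  case 0
  then show ?case by auto
next
  case (Suc k)
  \<comment> \<open>The walk is extended at its front: \<open>y\<close> is the vertex already
    controlled, \<open>x\<close> the new one. The invariant \<open>t\<close> is the depth below
    \<open>a\<close>.\<close>
  then obtain y where xy: "(x, y) \<in> gaifman (tree n P)"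
    and "(y, a * 2 ^ r) \<in> gaifman (tree n P) ^^ k"
    by (meson relpow_Suc_D2)
  with Suc obtain t where t: "r \<le> t + k" "t \<le> r + k" "y div 2 ^ t = a"
    by auto
  have "0 < y"
    using t(3) a(1) by (auto intro: gr0I)
  \<comment> \<open>The level of \<open>y\<close> is at most \<open>q + t\<close>, hence above the
    leaf level \<open>q + 2 * r\<close>, so both children of \<open>y\<close> lie in the
    tree.\<close>
  have "y < 2 ^ Suc q * 2 ^ t"
    using t(3) a(2) by (metis div_less_iff_less_mult zero_less_numeral zero_less_power)
  also have "\<dots> = 2 ^ (Suc q + t)"
    by (simp add: power_add)
  also have "\<dots> \<le> 2 ^ (n - 1)"
    using t(2) Suc.prems(2) n by (intro power_increasing) auto
  finally have "2 * y + 1 < 2 * 2 ^ (n - 1)" by simp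
  then have y: "2 * y + 1 < 2 ^ n"
    using n by simp
  \<comment> \<open>As \<open>k < r\<close>, \<open>y\<close> lies strictly below \<open>a\<close>,
    and its parent is still in the subtree.\<close>
  obtain s where s: "t = Suc s"
    using t(1) Suc.prems(2) by (cases t) auto
  consider "x = y" | "x = tree_S n y \<or> x = tree_E n y" | "y = tree_S n x \<or> y = tree_E n x"
    using gaifman_tree_cases[OF xy] by blast
  then show ?case
  proof cases
    case 1
    then show ?thesis using t by (intro exI[of _ t]) auto
  next
    case 2
    then have "x div 2 = y"
      using y by (auto simp: tree_S_def tree_E_def)
    then have "x div 2 ^ Suc t = a"
      using t(3) by (simp add: div_mult2_eq)
    then show ?thesis using t by (intro exI[of _ "Suc t"]) auto
  next
    case 3
    then have "y div 2 = x"
      using \<open>0 < y\<close> by (auto simp: tree_S_def tree_E_def split: if_splits)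
    then have "x div 2 ^ s = a"
      using t(3) s by (simp add: div_mult2_eq)
    then show ?thesis using t s by (intro exI[of _ s]) auto
  qed
qed

text \<open>The interval is level \<open>q\<close> of the heap; shifting any further drops below
  \<open>2 ^ q\<close>.\<close>

lemma ancestor_unique:
  fixes x :: nat
  assumes "x div 2 ^ s \<in> {2 ^ q..<2 ^ Suc q}" "x div 2 ^ t \<in> {2 ^ q..<2 ^ Suc q}"
  shows "x div 2 ^ s = x div 2 ^ t"
proof -
  have False if "s < t" "2 ^ q \<le> x div 2 ^ t" "x div 2 ^ s < 2 ^ Suc q" for s t
  proof -
    obtain d where d: "t = s + Suc d"
      using \<open>s < t\<close> less_iff_Suc_add by auto
    have "x div 2 ^ t = x div 2 ^ s div 2 div 2 ^ d"
      by (simp add: d power_add ac_simps flip: div_mult2_eq)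
    also have "\<dots> \<le> x div 2 ^ s div 2"
      by (rule div_le_dividend)
    also have "\<dots> < 2 ^ q"
      using that(3) by auto
    finally show False using that(2) by simp
  qed
  then show ?thesis
    using assms by (metis atLeastLessThan_iff nat_neq_iff)
qed

text \<open>Pigeonhole: each \<open>c\<close> has at most one ancestor on level \<open>q\<close>, so
  some \<open>a\<close> among the \<open>2 ^ q\<close> vertices there has no element of
  \<open>C\<close> in its subtree.\<close>

lemma exists_far_vertex:
  fixes C :: "nat set"
  assumes C: "finite C" "card C < 2 ^ q" and n: "n = q + 2 * r + 1"
  shows "\<exists>v. 0 < v \<and> v < 2 ^ n \<and> (\<forall>c\<in>C. \<not> gdist (tree n P) c v \<le> enat r)"
proof -
  let ?I = "{2 ^ q..<2 ^ Suc q} :: nat set"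
  have "\<exists>a\<in>?I. \<forall>c\<in>C. \<forall>t. c div 2 ^ t \<noteq> a"
  proof (rule ccontr)
    assume "\<not> ?thesis"
    then obtain f where f: "\<And>a. a \<in> ?I \<Longrightarrow> f a \<in> C \<and> (\<exists>t. f a div 2 ^ t = a)"
      by metis
    have "inj_on f ?I"
    proof (rule inj_onI)
      fix a b assume ab: "a \<in> ?I" "b \<in> ?I" "f a = f b"
      with f obtain s t where "f a div 2 ^ s = a" "f a div 2 ^ t = b" by metis
      with ab show "a = b" using ancestor_unique by metis
    qed
    then have "card ?I \<le> card C"
      using f C(1) by (intro card_inj_on_le[of f]) blast+
    then show False using C(2) by simp
  qed
  then obtain a where a: "a \<in> ?I" "\<And>c t. c \<in> C \<Longrightarrow> c div 2 ^ t \<noteq> a" by blast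
  have "0 < a"
    using a(1) by (metis atLeastLessThan_iff less_le_trans zero_less_numeral zero_less_power)
  \<comment> \<open>The far vertex is the leftmost descendant of \<open>a\<close>, \<open>r\<close>
    levels down.\<close>
  have "a * 2 ^ r < 2 ^ Suc q * 2 ^ r"
    using a(1) by simp
  also have "\<dots> = 2 ^ (Suc q + r)"
    by (simp add: power_add)
  also have "\<dots> \<le> 2 ^ n"
    using n by (intro power_increasing) auto
  finally have "a * 2 ^ r < 2 ^ n" .
  moreover have "\<not> gdist (tree n P) c (a * 2 ^ r) \<le> enat r" if "c \<in> C" for c
    using tree_walk_ancestor[OF \<open>0 < a\<close> _ n] a that
    unfolding gdist_le_enat atLeastLessThan_iff by metis
  ultimately show ?thesis
    using \<open>0 < a\<close> by (intro exI[of _ "a * 2 ^ r"]) auto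
qed

text \<open>Marking \<open>v\<close> changes no distance, and the only new tuple \<open>[v]\<close>
  lies outside the neighbourhood.\<close>

lemma nbhd_tree_far_vertex:
  assumes "0 < v" "v < 2 ^ n" "\<forall>c\<in>C. \<not> gdist (tree n {}) c v \<le> enat r"
  shows "nbhd (tree n {}) C r = nbhd (tree n {v}) C r"
proof -
  let ?X = "{x \<in> {..<2 ^ n}. \<exists>c\<in>C. gdist (tree n {}) c x \<le> enat r}"
  have "gdist (tree n {v}) = gdist (tree n {})"
    using gaifman_tree[of "{v}" n] assms by (simp add: gdist_def fun_eq_iff)
  moreover have "{t \<in> rel (tree n {}) R. set t \<subseteq> ?X} = {t \<in> rel (tree n {v}) R. set t \<subseteq> ?X}" for R
    using assms by (cases R) auto
  ultimately show ?thesis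
    by (simp add: nbhd_def induced_def)
qed

section \<open>Failure of existential locality\<close>

lemma not_equiv_existential_local:
  assumes "existential_local sigma_ar \<psi>"
  shows "\<not> equiv_fin sigma_ar fm_ends \<psi>"
proof
  assume equiv: "equiv_fin sigma_ar fm_ends \<psi>"
  obtain xs \<tau> r where xs: "distinct xs" and \<tau>: "local_fm sigma_ar r xs \<tau>"
    and \<psi>: "\<psi> = foldr Ex xs \<tau>"
    using assms by (auto simp: existential_local_def)
  have fv: "fv \<tau> \<subseteq> set xs"
    using \<tau> unfolding local_fm_def by (elim conjE)
  \<comment> \<open>At most \<open>q < 2 ^ q\<close> centres occur, so the depth can be fixed from
    \<open>xs\<close> and \<open>r\<close> before the witnesses are known.\<close>
  define q where "q = length xs"
  define n where "n = q + 2 * r + 1"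
  have fin: "finite_struct sigma_ar (tree n {})"
    by (simp add: finite_struct_tree)
  then have "tree n {} \<Turnstile> \<psi>"
    using equiv models_tree[of "{}" n] by (simp add: equiv_fin_def)
  then obtain w where w: "w ` set xs \<subseteq> univ (tree n {})" "sat (tree n {}) w \<tau>"
    unfolding \<psi> models_foldr_Ex[OF xs fv] by (elim exE conjE)
  have "card (w ` set xs) \<le> q"
    using card_image_le[of "set xs" w] card_length[of xs] by (simp add: q_def)
  also have "q < 2 ^ q" by simp
  finally obtain v where v: "0 < v" "v < 2 ^ n"
    "\<forall>c \<in> w ` set xs. \<not> gdist (tree n {}) c v \<le> enat r"
    using exists_far_vertex[OF _ _ n_def] by blast
  have fin': "finite_struct sigma_ar (tree n {v})"
    using v by (simp add: finite_struct_tree)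
  have "tree n {v} \<Turnstile> \<psi>"
    unfolding \<psi> using existential_local_transfer[OF \<tau> xs] fin fin' w nbhd_tree_far_vertex[OF v]
    by (simp add: finite_struct_def)
  then show False
    using equiv fin' models_tree[of "{v}" n] v by (simp add: equiv_fin_def)
qed

theorem corollary5p7:
  "\<exists>\<phi> :: sym fm. is_sentence sigma_ar \<phi> \<and> preserved_disj_union sigma_ar \<phi> \<and>
     \<not> (\<exists>\<psi>. existential_local sigma_ar \<psi> \<and> equiv_fin sigma_ar \<phi> \<psi>)"
  using is_sentence_fm_ends preserved_fm_ends not_equiv_existential_local by blast

end
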